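(* Let $R$ be a polynomial ring over a field and let $I$ be a square-free monomial ideal generated by $n$ square-free monomials in $R$, with minimal monomial generating set $f_1,\ldots,f_n$. When $n\leq 5$, then $\mathcal{R}(I)=S/J$, where $S=R[T_1,\ldots,T_n]$ and $$J=SJ_1+S\cdot\Big(\bigcup_{i=2}^{n-2}J_i\Big).$$ In particular, the relation type of $I$ satisfies ${\rm rt}(I)\leq n-2$.
   Context: For an ideal $I$ of $R$, the Rees algebra is $\mathcal{R}(I)=R[It]=\bigoplus_{i\ge 0}I^it^i\subset R[t]$, where $t$ is an indeterminate. For a monomial ideal $I$ with minimal monomial generating set $f_1,\ldots,f_n$, let $S=R[T_1,\ldots,T_n]$ be a polynomial ring in indeterminates $T_1,\ldots,T_n$, let $\phi:S\to\mathcal{R}(I)$ be the $R$-algebra epimorphism with $\phi(T_i)=f_it$, and let $J=\ker\phi$, so that $\mathcal{R}(I)\simeq S/J$. The ideal $J$ is graded by degree in the $T_i$. For $s\ge 1$, $\mathcal{I}_s$ is the set of non-decreasing sequences $\alpha=(i_1,\ldots,i_s)$ of length $s$ with entries in $\{1,\ldots,n\}$; put $f_\alpha=f_{i_1}\cdots f_{i_s}$ and $T_\alpha=T_{i_1}\cdots T_{i_s}$. For $\alpha,\beta\in\mathcal{I}_s$ put $$T_{\alpha,\beta}=\frac{f_\beta}{\gcd(f_\alpha,f_\beta)}T_\alpha-\frac{f_\alpha}{\gcd(f_\alpha,f_\beta)}T_\beta .$$ $J_s$ denotes the set $\{T_{\alpha,\beta}\mid \alpha,\beta\in\mathcal{I}_s\}$,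 and $S\cdot X$ (or $SX$) is the ideal of $S$ generated by $X$. The relation type ${\rm rt}(I)$ is the largest degree (in the $T_i$) of any minimal generator of $J$.
   Formalization: The bound rt(I) ≤ n-2 is stated as rt(I) ≤ max(1, n-2): the same for n ≥ 3, but for n = 2 the original fails (I = (x,y) has J = (xT_2 − yT_1), rt = 1), and for n = 1 one has J = 0 and n-2 is negative. *)

theory Defs
  imports
    "HOL-Library.Poly_Mapping"
    "HOL-Library.Extended_Nat"
    "HOL-Library.Cardinality"
    "HOL-Computational_Algebra.Polynomial"
    "HOL-Algebra.Ideal_Product"
    "HOL-Algebra.QuotRing"
    "HOL-Algebra.Algebraic_Closure_Type"
begin

text \<open>
  A monomial in the variables \<open>'x\<close> is given by its exponent vector. In \<open>('n, 'x, 'k) sring\<close> the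
  outer \<^const>\<open>Poly_Mapping.lookup\<close> yields coefficients in \<open>R\<close>: this is \<open>S = R[T\<^sub>i. i \<in> 'n]\<close>, where the
  index type \<open>'n\<close> (finite, linearly ordered) plays the role of \<open>{1,\<dots>,n}\<close>, so \<open>n = CARD('n)\<close>.
\<close>

type_synonym 'x expo = "'x \<Rightarrow>\<^sub>0 nat"
type_synonym ('x, 'k) rring = "'x expo \<Rightarrow>\<^sub>0 'k"
type_synonym ('n, 'x, 'k) sring = "('n \<Rightarrow>\<^sub>0 nat) \<Rightarrow>\<^sub>0 ('x, 'k) rring"

abbreviation typ_ring :: "'a::comm_ring_1 ring"
  where "typ_ring \<equiv> ring_of_type_algebra"

definition ideal_gen :: "'a::comm_ring_1 set \<Rightarrow> 'a set"
  where "ideal_gen A = genideal typ_ring A"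

primrec ideal_power :: "'a::comm_ring_1 set \<Rightarrow> nat \<Rightarrow> 'a set"
  where
    "ideal_power I 0 = UNIV"
  | "ideal_power I (Suc i) = ideal_prod typ_ring I (ideal_power I i)"

definition minimal_generating_set :: "'a::comm_ring_1 set \<Rightarrow> 'a set \<Rightarrow> bool"
  where "minimal_generating_set G I \<longleftrightarrow> ideal_gen G = I \<and> (\<forall>G'. G' \<subset> G \<longrightarrow> ideal_gen G' \<noteq> I)"

definition mono_of :: "'x expo \<Rightarrow> ('x, 'k::comm_ring_1) rring"
  where "mono_of a = Poly_Mapping.single a 1"

definition squarefree_expo :: "'x expo \<Rightarrow> bool"
  where "squarefree_expo a \<longleftrightarrow> (\<forall>x. Poly_Mapping.lookup a x \<le> 1)"

lift_definition gcd_expo :: "'x expo \<Rightarrow> 'x expo \<Rightarrow> 'x expo"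
  is "\<lambda>a b x. min (a x) (b x)"
  by (rule finite_subset[rotated]) auto

definition rees_algebra :: "'a::comm_ring_1 set \<Rightarrow> 'a poly set"
  where "rees_algebra I = {p. \<forall>i. Polynomial.coeff p i \<in> ideal_power I i}"

definition rees_ring :: "'a::comm_ring_1 set \<Rightarrow> 'a poly ring"
  where "rees_ring I = typ_ring\<lparr>carrier := rees_algebra I\<rparr>"

definition const_S :: "('x, 'k::comm_ring_1) rring \<Rightarrow> ('n, 'x, 'k) sring"
  where "const_S r = Poly_Mapping.single 0 r"

definition var_T :: "'n \<Rightarrow> ('n, 'x, 'k::comm_ring_1) sring"
  where "var_T i = Poly_Mapping.single (Poly_Mapping.single i 1) 1"

text \<open>The map \<open>\<phi>\<close>: evaluation at \<open>T\<^sub>i = f\<^sub>i t\<close>, where \<open>R[t]\<close> is the type \<open>('x, 'k) rring poly\<close>.\<close>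

definition rees_hom ::
    "('n::finite \<Rightarrow> 'x expo) \<Rightarrow> ('n, 'x, 'k::comm_ring_1) sring \<Rightarrow> ('x, 'k) rring poly"
  where "rees_hom f p =
    (\<Sum>m\<in>Poly_Mapping.keys p. [:Poly_Mapping.lookup p m:] *
       (\<Prod>i\<in>UNIV. Polynomial.monom (mono_of (f i)) 1 ^ Poly_Mapping.lookup m i))"

lemma rees_hom_const: "rees_hom f (const_S r) = [:r:]"
  by (cases "r = 0") (simp_all add: rees_hom_def const_S_def)

lemma rees_hom_var:
  fixes f :: "'n::finite \<Rightarrow> 'x expo"
  shows "rees_hom f (var_T i) = (Polynomial.monom (mono_of (f i)) 1 :: ('x, 'k::comm_ring_1) rring poly)"
proof -
  have "(\<Prod>j\<in>UNIV. Polynomial.monom (mono_of (f j)) 1 ^ Poly_Mapping.lookup (Poly_Mapping.single i (1::nat)) j)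
      = (\<Prod>j\<in>UNIV. if j = i then Polynomial.monom (mono_of (f j) :: ('x, 'k) rring) 1 else 1)"
    by (rule prod.cong) (auto simp: lookup_single when_def)
  then show ?thesis
    by (simp add: rees_hom_def var_T_def one_pCons [symmetric])
qed

definition rees_ideal :: "('n::finite \<Rightarrow> 'x expo) \<Rightarrow> ('n, 'x, 'k::comm_ring_1) sring set"
  where "rees_ideal f = a_kernel typ_ring typ_ring (rees_hom f)"

definition seqs :: "nat \<Rightarrow> 'n::linorder list set"
  where "seqs s = {\<alpha>. length \<alpha> = s \<and> sorted \<alpha>}"

definition f_seq :: "('n \<Rightarrow> 'x expo) \<Rightarrow> 'n list \<Rightarrow> 'x expo"
  where "f_seq f \<alpha> = (\<Sum>i\<leftarrow>\<alpha>. f i)"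

definition T_seq :: "'n list \<Rightarrow> ('n, 'x, 'k::comm_ring_1) sring"
  where "T_seq \<alpha> = (\<Prod>i\<leftarrow>\<alpha>. var_T i)"

text \<open>Quotients of monomials are differences of exponent vectors.\<close>

definition T_rel :: "('n \<Rightarrow> 'x expo) \<Rightarrow> 'n list \<Rightarrow> 'n list \<Rightarrow> ('n, 'x, 'k::comm_ring_1) sring"
  where "T_rel f \<alpha> \<beta> =
    (let g = gcd_expo (f_seq f \<alpha>) (f_seq f \<beta>) in
       const_S (mono_of (f_seq f \<beta> - g)) * T_seq \<alpha> - const_S (mono_of (f_seq f \<alpha> - g)) * T_seq \<beta>)"

definition J_set :: "('n::linorder \<Rightarrow> 'x expo) \<Rightarrow> nat \<Rightarrow> ('n, 'x, 'k::comm_ring_1) sring set"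
  where "J_set f s = {T_rel f \<alpha> \<beta> | \<alpha> \<beta>. \<alpha> \<in> seqs s \<and> \<beta> \<in> seqs s}"

definition T_homogeneous :: "nat \<Rightarrow> ('n::finite, 'x, 'k::comm_ring_1) sring \<Rightarrow> bool"
  where "T_homogeneous d p \<longleftrightarrow>
    (\<forall>m\<in>Poly_Mapping.keys p. (\<Sum>i\<in>UNIV. Poly_Mapping.lookup m i) = d)"

text \<open>
  The minimal generators of the graded ideal \<open>J\<close> are the members of inclusion-minimal generating
  sets consisting of elements homogeneous in the \<open>T\<^sub>i\<close>; without homogeneity their degrees could be
  raised arbitrarily. Such a set never contains \<open>0\<close>, so the degree \<open>d\<close> below is determined by \<open>g\<close>.
  For \<open>J = 0\<close> the supremum is \<open>0\<close>. The relation type of \<open>I\<close> is the value at \<open>J = rees_ideal f\<close>.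
\<close>

definition relation_type :: "('n::finite, 'x, 'k::comm_ring_1) sring set \<Rightarrow> enat"
  where "relation_type J =
    Sup {enat d | d g G. minimal_generating_set G J \<and> (\<forall>h\<in>G. \<exists>e. T_homogeneous e h) \<and>
                         g \<in> G \<and> T_homogeneous d g}"

end

theory Submission
  imports Defs
begin

text \<open>
  The ideal \<open>J\<close> is spanned by differences of terms with the same image, so it suffices to reduce the
  relation between \<open>T\<^sup>a\<close> and \<open>T\<^sup>b\<close>, for \<open>|a| = |b| = s\<close>, to lower degree when \<open>s > max(1, n - 2)\<close>. A common
  variable can be cancelled. If the supports are disjoint, then \<open>n \<le> 5\<close> leaves supports of sizes
  \<open>(1, q)\<close>, \<open>(2, 2)\<close> and \<open>(2, 3)\<close>; in each case there is an exponent vector \<open>c\<close> of degree \<open>s\<close> meeting both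
  supports such that \<open>f\<^sup>c\<close> divides \<open>lcm(f\<^sup>a, f\<^sup>b)\<close>. As the \<open>f\<^sub>i\<close> are square-free, the divisibility follows from
  \<open>c(V) \<le> max(a(V), b(V))\<close> for all sets \<open>V\<close> of indices. The bound on the relation type holds because a
  homogeneous element of degree at most \<open>d\<close> in an ideal with homogeneous generators only needs the
  generators of degree at most \<open>d\<close>.
\<close>

section \<open>Exchange of variables\<close>

definition weight :: "'n set \<Rightarrow> ('n \<Rightarrow>\<^sub>0 nat) \<Rightarrow> nat"
  where "weight V m = (\<Sum>i\<in>V. Poly_Mapping.lookup m i)"

lemma weight_add [simp]: "weight V (a + b) = weight V a + weight V b"
  by (simp add: weight_def lookup_add sum.distrib)

lemma weight_single [simp]:
  fixes V :: "'n::finite set"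
  shows "weight V (Poly_Mapping.single i k) = (if i \<in> V then k else 0)"
  by (simp add: weight_def lookup_single when_def)

lemma weight_mono: "V \<subseteq> Y \<Longrightarrow> weight V a \<le> weight Y a" for Y :: "'n::finite set"
  by (simp add: weight_def sum_mono2)

lemma weight_keys: "Poly_Mapping.keys a \<subseteq> V \<Longrightarrow> weight V a = weight UNIV a" for V :: "'n::finite set"
  unfolding weight_def by (rule sum.mono_neutral_left) (auto simp: in_keys_iff)

lemma lookup_le_weight: "i \<in> V \<Longrightarrow> Poly_Mapping.lookup a i \<le> weight V a" for V :: "'n::finite set"
  using weight_mono[of "{i}" V a] by (simp add: weight_def)

lemma weight_eq_0_iff: "weight UNIV a = 0 \<longleftrightarrow> a = 0" for a :: "'n::finite \<Rightarrow>\<^sub>0 nat"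
  by (auto simp: weight_def poly_mapping_eq_iff fun_eq_iff)

lemma split_off_single:
  assumes "Poly_Mapping.lookup a i \<ge> k"
  obtains a' :: "'n \<Rightarrow>\<^sub>0 nat" where "a = a' + Poly_Mapping.single i k"
proof
  show "a = (a - Poly_Mapping.single i k) + Poly_Mapping.single i k"
    using assms by (intro poly_mapping_eqI) (auto simp: lookup_add lookup_minus lookup_single when_def)
qed

lemma sum_single_keys: "(\<Sum>i\<in>Poly_Mapping.keys p. Poly_Mapping.single i (Poly_Mapping.lookup p i)) = p"
  by (rule poly_mapping_eqI) (simp add: lookup_sum lookup_single when_def in_keys_iff)

text \<open>
  A bridge reduces the binomial relation between \<open>T\<^sup>a\<close> and \<open>T\<^sup>b\<close> to two relations of lower degree:
  \<open>T\<^sup>c\<close> shares a variable with each of them, and testing \<open>c\<close> on all index sets \<open>V\<close> ensures that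
  \<open>f\<^sup>c\<close> divides \<open>lcm(f\<^sup>a, f\<^sup>b)\<close>, whatever the square-free monomials \<open>f\<^sub>i\<close> are.
\<close>

definition bridge :: "('n \<Rightarrow>\<^sub>0 nat) \<Rightarrow> ('n \<Rightarrow>\<^sub>0 nat) \<Rightarrow> ('n::finite \<Rightarrow>\<^sub>0 nat) \<Rightarrow> bool"
  where "bridge a b c \<longleftrightarrow> weight UNIV c = weight UNIV a
    \<and> Poly_Mapping.keys a \<inter> Poly_Mapping.keys c \<noteq> {}
    \<and> Poly_Mapping.keys b \<inter> Poly_Mapping.keys c \<noteq> {}
    \<and> (\<forall>V. weight V c \<le> max (weight V a) (weight V b))"

lemma bridge_sym:
  "weight UNIV a = weight UNIV b \<Longrightarrow> bridge a b c \<Longrightarrow> bridge b a c"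
  by (auto simp: bridge_def max.commute)

section \<open>Exchanging one or two variables\<close>

lemma keys_inter_nonempty:
  "Poly_Mapping.lookup a i \<noteq> 0 \<Longrightarrow> Poly_Mapping.lookup b i \<noteq> 0
    \<Longrightarrow> Poly_Mapping.keys a \<inter> Poly_Mapping.keys b \<noteq> {}"
  by (auto simp: in_keys_iff)

lemma keys_inter_add:
  fixes a c e :: "'n::finite \<Rightarrow>\<^sub>0 nat"
  assumes "weight UNIV a \<noteq> 0"
  shows "Poly_Mapping.keys (a + e) \<inter> Poly_Mapping.keys (a + c) \<noteq> {}"
proof -
  obtain k where "Poly_Mapping.lookup a k \<noteq> 0"
    using assms by (auto simp: weight_def)
  then show ?thesis
    by (intro keys_inter_nonempty[of _ k]) (simp_all add: lookup_add)
qed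

text \<open>One factor \<open>T_i\<close> of \<open>T^a\<close> is traded for \<open>T_j\<close>.
  Only sets \<open>V\<close> with j but not i gain weight, namely 1, and there a(V) \<le> s - a_i <
  b_j \<le> b(V) for the common degree s, so the gain stays below the maximum. Degree at least 2
  leaves a factor shared with \<open>a\<close>.\<close>

lemma bridge_exchange_one:
  fixes a b :: "'n::finite \<Rightarrow>\<^sub>0 nat"
  assumes s: "weight UNIV a = weight UNIV b" "weight UNIV b \<ge> 2"
    and i: "Poly_Mapping.lookup a i > 0" and j: "Poly_Mapping.lookup b j > 0"
    and large: "Poly_Mapping.lookup a i + Poly_Mapping.lookup b j > weight UNIV b"
  shows "\<exists>c. bridge a b c"
proof -
  obtain a' where a: "a = a' + Poly_Mapping.single i 1"
    using i by (metis One_nat_def Suc_leI split_off_single)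
  define c where "c = a' + Poly_Mapping.single j 1"
  have "weight V c \<le> max (weight V a) (weight V b)" for V
  proof (cases "i \<notin> V \<and> j \<in> V")
    case True
    have "weight V a + Poly_Mapping.lookup a i = weight (insert i V) a"
      using True by (simp add: weight_def)
    also have "\<dots> \<le> weight UNIV a"
      by (intro weight_mono) auto
    finally have "weight V a + 1 \<le> Poly_Mapping.lookup b j"
      using s large by linarith
    also have "\<dots> \<le> weight V b"
      using True by (simp add: lookup_le_weight)
    finally show ?thesis
      using True by (simp add: c_def a)
  qed (auto simp: c_def a)
  moreover have "weight UNIV a' \<noteq> 0"
    using s by (simp add: a)
  then have "Poly_Mapping.keys a \<inter> Poly_Mapping.keys c \<noteq> {}"
    unfolding a c_def by (rule keys_inter_add)
  moreover have "Poly_Mapping.keys b \<inter> Poly_Mapping.keys c \<noteq> {}"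
    using j by (intro keys_inter_nonempty[of _ j]) (simp_all add: c_def lookup_add)
  moreover have "weight UNIV c = weight UNIV a"
    by (simp add: c_def a)
  ultimately have "bridge a b c"
    unfolding bridge_def by blast
  then show ?thesis ..
qed

text \<open>The flags p, q, r, t record whether i, k, r, t lie in \<open>V\<close>. Weight is gained
  only if \<open>V\<close> meets {r, t} in more elements than {i, k}. If it misses i and k, then
  a(V) = 0 and the gain is covered by positive entries of \<open>b\<close>; if it contains one of
  them together with r and t, the gain is 1 and a(V) < b_r + b_t.\<close>

lemma exchange_two_arith:
  fixes wc wa wb ai ak br bt :: nat
  assumes "wc + (if p then 1 else 0) + (if q then 1 else 0) = wa + (if r then 1 else 0) + (if t then 1 else 0)"
    and "wa = (if p then ai else 0) + (if q then ak else 0)"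
    and "(if r then br else 0) + (if t then bt else 0) \<le> wb"
    and "br > 0" "bt > 0" "ai < br + bt" "ak < br + bt"
  shows "wc \<le> max wa wb"
  using assms by (cases p; cases q; cases r; cases t) (simp_all add: le_max_iff_disj)

text \<open>Here \<open>T_i T_k\<close> is traded for \<open>T_r T_t\<close>. Since i and k exhaust
  the support of \<open>a\<close>, the weight of \<open>a\<close> on any \<open>V\<close> is known
  exactly; degree at least 3 leaves a factor shared by \<open>a\<close> and
  \<open>c\<close>.\<close>

lemma bridge_exchange_two:
  fixes a b :: "'n::finite \<Rightarrow>\<^sub>0 nat"
  assumes s: "weight UNIV a = weight UNIV b" "weight UNIV b \<ge> 3"
    and A: "Poly_Mapping.keys a = {i, k}" "i \<noteq> k"
    and B: "r \<noteq> t" "Poly_Mapping.lookup b r > 0" "Poly_Mapping.lookup b t > 0"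
    and large: "Poly_Mapping.lookup a i < Poly_Mapping.lookup b r + Poly_Mapping.lookup b t"
      "Poly_Mapping.lookup a k < Poly_Mapping.lookup b r + Poly_Mapping.lookup b t"
  shows "\<exists>c. bridge a b c"
proof -
  have pos: "Poly_Mapping.lookup a i > 0" "Poly_Mapping.lookup a k > 0"
    using A(1) by (metis gr0I in_keys_iff insertCI)+
  obtain a'' where a'': "a = a'' + Poly_Mapping.single i 1"
    using pos by (auto intro: split_off_single[of 1 a i])
  then have "Poly_Mapping.lookup a'' k = Poly_Mapping.lookup a k"
    using A by (simp add: lookup_add lookup_single)
  then obtain a' where "a'' = a' + Poly_Mapping.single k 1"
    using pos by (auto intro: split_off_single[of 1 a'' k])
  then have a: "a = a' + (Poly_Mapping.single i 1 + Poly_Mapping.single k 1)"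
    by (simp add: a'' ac_simps)
  define c where "c = a' + (Poly_Mapping.single r 1 + Poly_Mapping.single t 1)"
  have wa: "weight V a = (if i \<in> V then Poly_Mapping.lookup a i else 0)
      + (if k \<in> V then Poly_Mapping.lookup a k else 0)" for V
  proof -
    have "weight V a = (\<Sum>l\<in>V \<inter> {i, k}. Poly_Mapping.lookup a l)"
      unfolding weight_def using A(1) by (intro sum.mono_neutral_right) (auto simp flip: not_in_keys_iff_lookup_eq_zero)
    then show ?thesis
      using A(2) by auto
  qed
  have wb: "(if r \<in> V then Poly_Mapping.lookup b r else 0)
      + (if t \<in> V then Poly_Mapping.lookup b t else 0) \<le> weight V b" for V
  proof -
    have "(\<Sum>l\<in>V \<inter> {r, t}. Poly_Mapping.lookup b l) \<le> weight V b"
      unfolding weight_def by (intro sum_mono2) auto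
    then show ?thesis
      using B(1) by auto
  qed
  have "weight V c \<le> max (weight V a) (weight V b)" for V
  proof -
    have "weight V c + (if i \<in> V then 1 else 0) + (if k \<in> V then 1 else 0)
        = weight V a + (if r \<in> V then 1 else 0) + (if t \<in> V then 1 else 0)"
      by (simp add: c_def a)
    then show ?thesis
      using wa[of V] wb[of V] B(2,3) large by (rule exchange_two_arith)
  qed
  moreover have "weight UNIV a' \<noteq> 0"
    using s by (simp add: a)
  then have "Poly_Mapping.keys a \<inter> Poly_Mapping.keys c \<noteq> {}"
    unfolding a c_def by (rule keys_inter_add)
  moreover have "Poly_Mapping.keys b \<inter> Poly_Mapping.keys c \<noteq> {}"
    using B by (intro keys_inter_nonempty[of _ r]) (simp_all add: c_def lookup_add)
  moreover have "weight UNIV c = weight UNIV a"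
    by (simp add: c_def a)
  ultimately have "bridge a b c"
    unfolding bridge_def by blast
  then show ?thesis ..
qed

text \<open>
  The only configuration with \<open>n \<le> 5\<close> that no exchange of one or two variables resolves. For \<open>h = 1\<close>
  it has no bridge at all, which is why \<open>n - 2 = 3\<close> is needed when \<open>n = 5\<close>.
\<close>

lemma bridge_balanced:
  fixes i k r t v :: "'n::finite" and h :: nat
  assumes h: "h \<ge> 2"
    and a: "a = Poly_Mapping.single i (2 * h) + Poly_Mapping.single k h"
    and b: "b = Poly_Mapping.single r h + Poly_Mapping.single t h + Poly_Mapping.single v h"
  shows "\<exists>c. bridge a b c"
proof -
  obtain g where g: "h = Suc g" "g > 0"
    using h by (cases h) auto
  define c where "c = Poly_Mapping.single i (2 * g) + Poly_Mapping.single k g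
    + Poly_Mapping.single r 1 + Poly_Mapping.single t 1 + Poly_Mapping.single v 1"
  have "weight V c \<le> max (weight V a) (weight V b)" for V
    using g by (cases "i \<in> V"; cases "k \<in> V"; cases "r \<in> V"; cases "t \<in> V"; cases "v \<in> V")
      (simp_all add: a b c_def le_max_iff_disj)
  moreover have "Poly_Mapping.keys a \<inter> Poly_Mapping.keys c \<noteq> {}"
    using g by (intro keys_inter_nonempty[of _ i]) (simp_all add: c_def a lookup_add)
  moreover have "Poly_Mapping.keys b \<inter> Poly_Mapping.keys c \<noteq> {}"
    using g by (intro keys_inter_nonempty[of _ r]) (simp_all add: c_def b lookup_add)
  moreover have "weight UNIV c = weight UNIV a"
    by (simp add: c_def a g)
  ultimately have "bridge a b c"
    unfolding bridge_def by blast
  then show ?thesis ..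
qed

text \<open>The last three bounds make x, y, z at most s - p = q. Conversely any two of them sum to
  at most p, so the third is at least s - p = q. Hence s = 3q and p = 2q.\<close>

lemma balanced_weights:
  fixes p q x y z s :: nat
  assumes "p + q = s" "x + y + z = s" "q \<le> p"
    and "x + y \<le> max p q" "x + z \<le> max p q" "y + z \<le> max p q"
    and "p + x \<le> s" "p + y \<le> s" "p + z \<le> s"
  shows "x = q" "y = q" "z = q" "p = 2 * q"
  using assms by (simp_all add: max_absorb1)

lemma card_cases:
  fixes x y n :: nat
  assumes "x \<noteq> 0" "x \<noteq> 1" "x \<le> y" "x + y \<le> n" "n \<le> 5"
  shows "x = 2" "y = 2 \<and> n \<ge> 4 \<or> y = 3 \<and> n = 5"
  using assms by presburger+

text \<open>Failure of an exchange yields inequalities. Failure of all exchanges of one variable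
  rules out a support of size 1; failure of all exchanges of two variables then leaves only the
  balanced configuration of \<open>bridge_balanced\<close>.\<close>

lemma bridge_exists_aux:
  fixes a b :: "'n::finite \<Rightarrow>\<^sub>0 nat" and n :: nat
  assumes s: "weight UNIV a = weight UNIV b" "weight UNIV b > max 1 (n - 2)"
    and n: "n \<le> 5" and card: "card (Poly_Mapping.keys a) + card (Poly_Mapping.keys b) \<le> n"
    and disj: "Poly_Mapping.keys a \<inter> Poly_Mapping.keys b = {}"
    and le: "card (Poly_Mapping.keys a) \<le> card (Poly_Mapping.keys b)"
  shows "\<exists>c. bridge a b c"
proof (cases "\<exists>i\<in>Poly_Mapping.keys a. \<exists>j\<in>Poly_Mapping.keys b.
    Poly_Mapping.lookup a i + Poly_Mapping.lookup b j > weight UNIV b")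
  case True
  then show ?thesis
    using bridge_exchange_one[OF s(1)] s(2) by (auto simp: in_keys_iff)
next
  case False
  then have small: "Poly_Mapping.lookup a i + Poly_Mapping.lookup b j \<le> weight UNIV b"
    if "i \<in> Poly_Mapping.keys a" "j \<in> Poly_Mapping.keys b" for i j
    using that by (meson not_le)
  have wa: "(\<Sum>l\<in>Poly_Mapping.keys a. Poly_Mapping.lookup a l) = weight UNIV b"
    using weight_keys[of a "Poly_Mapping.keys a"] s by (simp add: weight_def)
  have wb: "(\<Sum>l\<in>Poly_Mapping.keys b. Poly_Mapping.lookup b l) = weight UNIV b"
    using weight_keys[of b "Poly_Mapping.keys b"] by (simp add: weight_def)
  have ne: "card (Poly_Mapping.keys b) \<noteq> 0"
    using s(2) wb by auto
  have "card (Poly_Mapping.keys a) \<noteq> 0"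
    using s(2) wa by auto
  moreover have "card (Poly_Mapping.keys a) \<noteq> 1"
  \<comment> \<open>On a one-element support a_i is the whole degree, so a_i + b_j exceeds it for
    every j in the support of \<open>b\<close>.\<close>
  proof
    assume "card (Poly_Mapping.keys a) = 1"
    then obtain i where i: "Poly_Mapping.keys a = {i}"
      by (auto simp: card_1_singleton_iff)
    obtain j where j: "j \<in> Poly_Mapping.keys b"
      using ne by fastforce
    then show False
      using small[of i j] wa i by (simp add: in_keys_iff)
  qed
  ultimately have ca: "card (Poly_Mapping.keys a) = 2"
    and cb: "card (Poly_Mapping.keys b) = 2 \<and> n \<ge> 4 \<or> card (Poly_Mapping.keys b) = 3 \<and> n = 5"
    using card_cases[OF _ _ le card n] by blast+
  from ca obtain i k where ik: "Poly_Mapping.keys a = {i, k}" "i \<noteq> k"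
    unfolding card_2_iff by blast
  have sa: "Poly_Mapping.lookup a i + Poly_Mapping.lookup a k = weight UNIV b"
    using wa ik by simp
  have pa: "Poly_Mapping.lookup a i > 0" "Poly_Mapping.lookup a k > 0"
    using ik(1) by (metis gr0I in_keys_iff insertCI)+
  \<comment> \<open>Both possible sizes of the support of \<open>b\<close> come with n \<ge> 4, so
    the degree exceeds n - 2 \<ge> 2.\<close>
  have s3: "weight UNIV b \<ge> 3"
    using s(2) cb by (elim disjE conjE) simp_all
  have two: ?thesis if "r \<in> Poly_Mapping.keys b" "t \<in> Poly_Mapping.keys b" "r \<noteq> t"
      "Poly_Mapping.lookup a i < Poly_Mapping.lookup b r + Poly_Mapping.lookup b t"
      "Poly_Mapping.lookup a k < Poly_Mapping.lookup b r + Poly_Mapping.lookup b t" for r t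
    using that bridge_exchange_two[OF s(1) s3 ik that(3)] by (simp add: in_keys_iff)
  show ?thesis
  proof (cases "card (Poly_Mapping.keys b) = 2")
    case True
    then obtain r t where "Poly_Mapping.keys b = {r, t}" "r \<noteq> t"
      unfolding card_2_iff by blast
    \<comment> \<open>Now b_r + b_t is the whole degree, which is larger than either of the positive
      entries a_i and a_k.\<close>
    then show ?thesis
      using wb sa pa by (intro two[of r t]) auto
  next
    case False
    then have B: "card (Poly_Mapping.keys b) = 3 \<and> n = 5"
      using cb by simp
    then obtain r t v where rtv: "Poly_Mapping.keys b = {r, t, v}" "r \<noteq> t" "t \<noteq> v" "r \<noteq> v"
      unfolding card_3_iff by blast
    have sb: "Poly_Mapping.lookup b r + Poly_Mapping.lookup b t + Poly_Mapping.lookup b v = weight UNIV b"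
      using wb rtv by simp
    show ?thesis
    proof (rule ccontr)
      assume contra: "\<nexists>c. bridge a b c"
      let ?a = "Poly_Mapping.lookup a" and ?b = "Poly_Mapping.lookup b"
      have "?b x + ?b y \<le> max (?a i) (?a k)"
        if "x \<in> Poly_Mapping.keys b" "y \<in> Poly_Mapping.keys b" "x \<noteq> y" for x y
        using contra two[OF that] by (meson max_less_iff_conj not_le)
      then have sums: "?b r + ?b t \<le> max (?a i) (?a k)" "?b r + ?b v \<le> max (?a i) (?a k)"
        "?b t + ?b v \<le> max (?a i) (?a k)"
        using rtv by simp_all
      have cross: "?a i + ?b r \<le> weight UNIV b" "?a i + ?b t \<le> weight UNIV b" "?a i + ?b v \<le> weight UNIV b"
        "?a k + ?b r \<le> weight UNIV b" "?a k + ?b t \<le> weight UNIV b" "?a k + ?b v \<le> weight UNIV b"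
        using small[of i] small[of k] rtv(1) ik(1) by simp_all
      \<comment> \<open>The bounds from both kinds of failed exchange force the exponents to be (2h,
        h) and (h, h, h), up to swapping i and k.\<close>
      have rel: "?b t = ?b r \<and> ?b v = ?b r \<and>
          (?a i = 2 * ?b r \<and> ?a k = ?b r \<or> ?a k = 2 * ?b r \<and> ?a i = ?b r)"
      proof (cases "?a k \<le> ?a i")
        case True
        show ?thesis
          using balanced_weights[OF sa sb True sums cross(1-3)] by simp
      next
        case False
        then have "?a i \<le> ?a k"
          by simp
        then show ?thesis
          using balanced_weights[OF trans[OF add.commute sa] sb _ sums[unfolded max.commute[of "?a i"]] cross(4-6)]
          by simp
      qed
      define h where "h = ?b r"
      have b: "b = Poly_Mapping.single r h + Poly_Mapping.single t h + Poly_Mapping.single v h"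
        using rtv(2-4) rel
        by (subst sum_single_keys[symmetric]) (simp add: rtv(1) h_def add.assoc)
      have "?a i = 2 * h \<and> ?a k = h \<or> ?a k = 2 * h \<and> ?a i = h"
        using rel by (simp add: h_def)
      then have a: "a = Poly_Mapping.single i (2 * h) + Poly_Mapping.single k h
          \<or> a = Poly_Mapping.single k (2 * h) + Poly_Mapping.single i h"
      proof
        assume "?a i = 2 * h \<and> ?a k = h"
        then have "a = Poly_Mapping.single i (2 * h) + Poly_Mapping.single k h"
          using ik(2) by (subst sum_single_keys[symmetric]) (simp add: ik(1) add.commute)
        then show ?thesis ..
      next
        assume "?a k = 2 * h \<and> ?a i = h"
        then have "a = Poly_Mapping.single k (2 * h) + Poly_Mapping.single i h"
          using ik(2) by (subst sum_single_keys[symmetric]) (simp add: ik(1) add.commute)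
        then show ?thesis ..
      qed
      \<comment> \<open>The degree is 3h and exceeds n - 2 = 3.\<close>
      have h: "h \<ge> 2"
        using s B sb rel by (auto simp: h_def)
      then show False
        using contra a bridge_balanced[OF h _ b, of a i k] bridge_balanced[OF h _ b, of a k i] by blast
    qed
  qed
qed

text \<open>Bridges are symmetric for equal degrees, so the smaller support may be taken
  first.\<close>

lemma bridge_exists:
  fixes a b :: "'n::finite \<Rightarrow>\<^sub>0 nat"
  assumes s: "weight UNIV a = weight UNIV b" "weight UNIV b > max 1 (CARD('n) - 2)"
    and n: "CARD('n) \<le> 5" and disj: "Poly_Mapping.keys a \<inter> Poly_Mapping.keys b = {}"
  shows "\<exists>c. bridge a b c"
proof -
  have card: "card (Poly_Mapping.keys a) + card (Poly_Mapping.keys b) \<le> CARD('n)"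
    unfolding card_Un_disjoint[OF finite_keys finite_keys disj, symmetric] by (rule card_mono) auto
  show ?thesis
  proof (cases "card (Poly_Mapping.keys a) \<le> card (Poly_Mapping.keys b)")
    case True
    show ?thesis
      by (rule bridge_exists_aux[OF s n card disj True])
  next
    case False
    then have "\<exists>c. bridge b a c"
      using s card disj by (intro bridge_exists_aux[OF _ _ n]) (simp_all add: Int_commute add.commute)
    then show ?thesis
      using bridge_sym[OF s(1)[symmetric]] by blast
  qed
qed

section \<open>Ideals of a commutative ring type\<close>

text \<open>Negation is multiplication by -1, and commutativity makes multiplication on one side
  enough.\<close>

lemma ideal_typ_ring_iff:
  "ideal J (typ_ring :: 'a::comm_ring_1 ring) \<longleftrightarrow>
    0 \<in> J \<and> (\<forall>a\<in>J. \<forall>b\<in>J. a + b \<in> J) \<and> (\<forall>r. \<forall>a\<in>J. r * a \<in> J)"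
proof
  assume "ideal J (typ_ring :: 'a ring)"
  then interpret ideal J "typ_ring :: 'a ring" .
  show "0 \<in> J \<and> (\<forall>a\<in>J. \<forall>b\<in>J. a + b \<in> J) \<and> (\<forall>r. \<forall>a\<in>J. r * a \<in> J)"
    using additive_subgroup.zero_closed[OF is_additive_subgroup]
      additive_subgroup.a_closed[OF is_additive_subgroup] I_l_closed
    by (auto simp: ring_of_type_algebra_def)
next
  interpret R: ring "typ_ring :: 'a ring"
    by (rule ring_from_type_algebra)
  assume J: "0 \<in> J \<and> (\<forall>a\<in>J. \<forall>b\<in>J. a + b \<in> J) \<and> (\<forall>r. \<forall>a\<in>J. r * a \<in> J)"
  have minus: "inv\<^bsub>add_monoid typ_ring\<^esub> a = - a" for a :: 'a
    unfolding a_inv_def[symmetric]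
    by (rule R.add.inv_equality[folded a_inv_def]) (auto simp: ring_of_type_algebra_def)
  have "- a \<in> J" if "a \<in> J" for a
    using J that by (metis mult_minus1)
  then have "subgroup J (add_monoid typ_ring)"
    using J by (auto simp: subgroup_def ring_of_type_algebra_def minus[unfolded ring_of_type_algebra_def, simplified])
  moreover have "a * r \<in> J" if "a \<in> J" for a r
    using J that by (metis mult.commute)
  ultimately show "ideal J (typ_ring :: 'a ring)"
    using J by (intro idealI R.ring_axioms) (auto simp: ring_of_type_algebra_def)
qed

lemma
  assumes "ideal J (typ_ring :: 'a::comm_ring_1 ring)"
  shows ideal_zero: "0 \<in> J"
    and ideal_add: "a \<in> J \<Longrightarrow> b \<in> J \<Longrightarrow> a + b \<in> J"
    and ideal_mult: "a \<in> J \<Longrightarrow> r * a \<in> J"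
  using assms by (auto simp: ideal_typ_ring_iff)

lemma ideal_diff:
  assumes "ideal J (typ_ring :: 'a::comm_ring_1 ring)" "a \<in> J" "b \<in> J"
  shows "a - b \<in> J"
  using ideal_add[OF assms(1,2) ideal_mult[OF assms(1,3), of "- 1"]] by simp

lemma ideal_ideal_gen: "ideal (ideal_gen G) (typ_ring :: 'a::comm_ring_1 ring)"
  unfolding ideal_gen_def
  by (rule ring.genideal_ideal[OF ring_from_type_algebra]) (simp add: ring_of_type_algebra_def)

lemma ideal_gen_superset: "G \<subseteq> ideal_gen G" for G :: "'a::comm_ring_1 set"
  unfolding ideal_gen_def
  by (rule ring.genideal_self[OF ring_from_type_algebra]) (simp add: ring_of_type_algebra_def)

lemma ideal_gen_minimal: "ideal J typ_ring \<Longrightarrow> G \<subseteq> J \<Longrightarrow> ideal_gen G \<subseteq> J"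
  for J :: "'a::comm_ring_1 set"
  unfolding ideal_gen_def by (rule ring.genideal_minimal[OF ring_from_type_algebra])

section \<open>The presentation of the Rees algebra\<close>

text \<open>This induction serves both layers of \<open>S\<close>: polynomials in the
  \<open>T_i\<close> over \<open>R\<close>, and their coefficients in \<open>R\<close>.\<close>

lemma poly_mapping_additive_induct [case_names zero single add]:
  fixes P :: "('a \<Rightarrow>\<^sub>0 'b::comm_monoid_add) \<Rightarrow> bool"
  assumes "P 0" "\<And>m r. P (Poly_Mapping.single m r)" "\<And>p q. P p \<Longrightarrow> P q \<Longrightarrow> P (p + q)"
  shows "P p"
proof -
  have "P (\<Sum>i\<in>A. Poly_Mapping.single i (Poly_Mapping.lookup p i))" for A
    by (induction A rule: infinite_finite_induct) (auto intro: assms)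
  from this[of "Poly_Mapping.keys p"] show ?thesis
    by (simp only: sum_single_keys)
qed

section \<open>Images of terms under the map to \<open>R[t]\<close>\<close>

lemma mono_of_add: "mono_of (a + b) = mono_of a * (mono_of b :: ('x, 'k::comm_ring_1) rring)"
  by (simp add: mono_of_def mult_single)

lemma mono_of_sum: "mono_of (\<Sum>i\<in>A. g i) = (\<Prod>i\<in>A. mono_of (g i) :: ('x, 'k::comm_ring_1) rring)"
  by (induction A rule: infinite_finite_induct) (simp_all add: mono_of_add, simp_all add: mono_of_def)

lemma prod_monom: "(\<Prod>i\<in>A. Polynomial.monom (c i) (d i)) = Polynomial.monom (\<Prod>i\<in>A. c i) (\<Sum>i\<in>A. d i)"
  by (induction A rule: infinite_finite_induct) (simp_all add: mult_monom)

text \<open>The exponent vector of \<open>f^m\<close>: \<open>rees_hom\<close> sends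
  \<open>T^m\<close> to \<open>f^m t^|m|\<close>.\<close>

definition expo_comb :: "('n::finite \<Rightarrow> 'x expo) \<Rightarrow> ('n \<Rightarrow>\<^sub>0 nat) \<Rightarrow> 'x expo"
  where "expo_comb f m = (\<Sum>i\<in>UNIV. \<Sum>_<Poly_Mapping.lookup m i. f i)"

lemma lookup_expo_comb:
  "Poly_Mapping.lookup (expo_comb f m) x = (\<Sum>i\<in>UNIV. Poly_Mapping.lookup m i * Poly_Mapping.lookup (f i) x)"
  by (simp add: expo_comb_def lookup_sum)

lemma expo_comb_add: "expo_comb f (a + b) = expo_comb f a + expo_comb f b"
  by (rule poly_mapping_eqI) (simp add: lookup_expo_comb lookup_add algebra_simps sum.distrib)

lemma expo_comb_single: "expo_comb f (Poly_Mapping.single i 1) = f i"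
  by (rule poly_mapping_eqI) (simp add: lookup_expo_comb lookup_single when_def if_distrib[of "\<lambda>y. y * _"] cong: if_cong)

lemma expo_comb_zero [simp]: "expo_comb f 0 = 0"
  by (simp add: expo_comb_def)

lemma rees_hom_single:
  fixes f :: "'n::finite \<Rightarrow> 'x expo" and r :: "('x, 'k::comm_ring_1) rring"
  shows "rees_hom f (Poly_Mapping.single m r) = Polynomial.monom (r * mono_of (expo_comb f m)) (weight UNIV m)"
proof -
  have "(\<Prod>i\<in>UNIV. Polynomial.monom (mono_of (f i) :: ('x, 'k) rring) 1 ^ Poly_Mapping.lookup m i)
      = (\<Prod>i\<in>UNIV. Polynomial.monom (mono_of (\<Sum>_<Poly_Mapping.lookup m i. f i)) (Poly_Mapping.lookup m i))"
    by (simp add: monom_power mono_of_sum)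
  also have "\<dots> = Polynomial.monom (mono_of (expo_comb f m)) (weight UNIV m)"
    by (simp add: prod_monom expo_comb_def weight_def mono_of_sum[of "\<lambda>i. \<Sum>_<Poly_Mapping.lookup m i. f i"])
  finally show ?thesis
    by (cases "r = 0") (simp_all add: rees_hom_def smult_monom)
qed

lemma rees_hom_zero [simp]: "rees_hom f 0 = 0"
  by (simp add: rees_hom_def)

lemma rees_hom_add: "rees_hom f (p + q) = rees_hom f p + rees_hom f q"
  unfolding rees_hom_def by (rule setsum_keys_plus_distrib) (simp_all add: algebra_simps flip: smult_add_left)

lemma rees_hom_mult: "rees_hom f (p * q) = rees_hom f p * rees_hom f q"
proof (induction p rule: poly_mapping_additive_induct)
  case (single m r)
  show ?case
  proof (induction q rule: poly_mapping_additive_induct)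
    case (single m' r')
    then show ?case
      by (simp add: mult_single rees_hom_single mult_monom expo_comb_add mono_of_add ac_simps)
  qed (simp_all add: algebra_simps rees_hom_add)
qed (simp_all add: algebra_simps rees_hom_add)

lemma rees_hom_diff: "rees_hom f (p - q) = rees_hom f p - rees_hom f q"
  using rees_hom_add[of f "p - q" q] by (simp add: algebra_simps)

lemma ring_hom_rees_hom: "ring_hom_ring typ_ring typ_ring (rees_hom f)"
proof (intro ring_hom_ringI ring_from_type_algebra)
  have "rees_hom f 1 = 1"
    using rees_hom_const[of f 1] by (simp add: const_S_def one_pCons)
  then show "rees_hom f \<one>\<^bsub>typ_ring\<^esub> = \<one>\<^bsub>typ_ring\<^esub>"
    by (simp add: ring_of_type_algebra_def)
qed (simp_all add: ring_of_type_algebra_def rees_hom_add rees_hom_mult)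

lemma mem_rees_ideal: "p \<in> rees_ideal f \<longleftrightarrow> rees_hom f p = 0"
  by (simp add: rees_ideal_def a_kernel_def' ring_of_type_algebra_def)

lemma ideal_rees_ideal: "ideal (rees_ideal f) typ_ring"
  by (simp add: ideal_typ_ring_iff mem_rees_ideal rees_hom_add rees_hom_mult)

section \<open>Surjectivity onto the Rees algebra\<close>

lemma ideal_ideal_power:
  assumes "ideal I typ_ring"
  shows "ideal (ideal_power I i) typ_ring"
proof (induction i)
  case 0
  then show ?case
    by (simp add: ideal_typ_ring_iff)
next
  case (Suc i)
  then show ?case
    using ring.ideal_prod_is_ideal[OF ring_from_type_algebra assms] by simp
qed

lemma mono_of_expo_comb_in_ideal_power:
  assumes "\<And>i. mono_of (f i) \<in> I"
  shows "weight UNIV m = s \<Longrightarrow> mono_of (expo_comb f m) \<in> ideal_power I s"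
proof (induction s arbitrary: m)
  case (Suc s)
  then have "weight UNIV m \<noteq> 0"
    by simp
  then obtain i where "Poly_Mapping.lookup m i > 0"
    by (auto simp: weight_def)
  then obtain m' where m: "m = m' + Poly_Mapping.single i 1"
    by (auto intro: split_off_single[of 1 m i])
  then have "mono_of (expo_comb f m') \<in> ideal_power I s"
    using Suc by simp
  then have "mono_of (f i) \<otimes>\<^bsub>typ_ring\<^esub> mono_of (expo_comb f m') \<in> ideal_power I (Suc s)"
    using assms by (auto intro: ideal_prod.prod)
  then show ?case
    by (simp add: m expo_comb_add expo_comb_single[simplified] mono_of_def mult_single ring_of_type_algebra_def ac_simps)
qed simp

text \<open>One inclusion is checked on terms. For the other, the coefficients r with
  \<open>r t^i\<close> in the image contain \<open>I^i\<close>, by induction on i: degree 1 contains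
  the generators \<open>f_i\<close>, and products of images are images.\<close>

lemma range_rees_hom:
  assumes I: "I = ideal_gen (range (\<lambda>i. mono_of (f i)))"
  shows "range (rees_hom f) = rees_algebra I"
proof (intro equalityI subsetI)
  have "ideal I typ_ring"
    by (simp add: I ideal_ideal_gen)
  note ideal_I = ideal_ideal_power[OF this]
  have gen: "mono_of (f i) \<in> I" for i
    unfolding I by (rule subsetD[OF ideal_gen_superset]) simp
  have "rees_hom f p \<in> rees_algebra I" for p
  proof (induction p rule: poly_mapping_additive_induct)
    case (single m r)
    have "r * mono_of (expo_comb f m) \<in> ideal_power I (weight UNIV m)"
      by (intro ideal_mult[OF ideal_I] mono_of_expo_comb_in_ideal_power[OF gen refl])
    then show ?case
      by (auto simp: rees_algebra_def rees_hom_single intro: ideal_zero[OF ideal_I])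
  qed (auto simp: rees_algebra_def rees_hom_add intro: ideal_zero[OF ideal_I] ideal_add[OF ideal_I])
  then show "q \<in> rees_algebra I" if "q \<in> range (rees_hom f)" for q
    using that by auto
next
  fix q assume q: "q \<in> rees_algebra I"
  let ?W = "\<lambda>i. {r. Polynomial.monom r i \<in> range (rees_hom f)}"
  have add: "a + b \<in> range (rees_hom f)" if "a \<in> range (rees_hom f)" "b \<in> range (rees_hom f)" for a b
    using that by (auto simp flip: rees_hom_add)
  have mult: "a * b \<in> range (rees_hom f)" if "a \<in> range (rees_hom f)" "b \<in> range (rees_hom f)" for a b
    using that by (auto simp flip: rees_hom_mult)
  have zero: "0 \<in> range (rees_hom f)"
    by (rule range_eqI[of _ _ 0]) simp
  have W0: "r \<in> ?W 0" for r
    using rangeI[of "rees_hom f" "const_S r"] by (simp add: monom_0 rees_hom_const)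
  have scale: "Polynomial.monom (r * a) i \<in> range (rees_hom f)"
    if "Polynomial.monom a i \<in> range (rees_hom f)" for r a i
    using mult[OF _ that, of "Polynomial.monom r 0"] W0[of r] by (simp add: mult_monom)
  \<comment> \<open>Being an ideal, \<open>?W 1\<close> contains all of \<open>I\<close> as soon as
    it contains each \<open>f_i\<close>, and \<open>f_i t\<close> is the image of
    \<open>T_i\<close>.\<close>
  have "ideal (?W 1) typ_ring"
    by (auto simp: ideal_typ_ring_iff zero scale add simp flip: add_monom)
  moreover have "range (\<lambda>i. mono_of (f i)) \<subseteq> ?W 1"
    using rangeI[of "rees_hom f" "var_T _"] by (auto simp: rees_hom_var)
  ultimately have W1: "I \<subseteq> ?W 1"
    unfolding I by (rule ideal_gen_minimal)
  have W: "ideal_power I i \<subseteq> ?W i" for i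
  proof (induction i)
    case (Suc i)
    have "r \<in> ?W (Suc i)" if "r \<in> ideal_prod typ_ring I (ideal_power I i)" for r
      using that
    proof induction
      case (prod a b)
      then show ?case
        using mult[of "Polynomial.monom a 1" "Polynomial.monom b i"] W1 Suc
        by (auto simp: mult_monom ring_of_type_algebra_def)
    next
      case (sum a b)
      then show ?case
        using add by (auto simp: ring_of_type_algebra_def simp flip: add_monom)
    qed
    then show ?case
      by auto
  qed (use W0 in auto)
  have "(\<Sum>i\<in>A. Polynomial.monom (Polynomial.coeff q i) i) \<in> range (rees_hom f)" for A
    using q W by (induction A rule: infinite_finite_induct) (auto simp: rees_algebra_def intro!: zero add)
  from this[of "{..degree q}"] show "q \<in> range (rees_hom f)"
    by (simp only: poly_as_sum_of_monoms)
qed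

lemma rees_ring_iso:
  fixes I :: "('x, 'k::comm_ring_1) rring set" and f :: "'n::finite \<Rightarrow> 'x expo"
  assumes "I = ideal_gen (range (\<lambda>i. mono_of (f i)))"
  shows "(\<lambda>C. the_elem (rees_hom f ` C)) \<in>
    ring_iso (typ_ring Quot (rees_ideal f :: ('n, 'x, 'k) sring set)) (rees_ring I)"
proof -
  have "rees_hom f ` carrier (typ_ring :: ('n, 'x, 'k) sring ring) = rees_algebra I"
    using range_rees_hom[OF assms] by (simp add: ring_of_type_algebra_def)
  with ring_hom_ring.FactRing_iso_set_aux[OF ring_hom_rees_hom[of f]]
  show ?thesis
    unfolding rees_ring_def rees_ideal_def by metis
qed

section \<open>Binomial relations\<close>

text \<open>Both \<open>T_seq\<close> and \<open>f_seq\<close> depend on a sequence only through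
  this exponent vector, so sequences can be replaced by exponents.\<close>

definition expo_of :: "'n list \<Rightarrow> 'n \<Rightarrow>\<^sub>0 nat"
  where "expo_of \<alpha> = (\<Sum>i\<leftarrow>\<alpha>. Poly_Mapping.single i 1)"

lemma T_seq_eq: "(T_seq \<alpha> :: ('n, 'x, 'k::comm_ring_1) sring) = Poly_Mapping.single (expo_of \<alpha>) 1"
  by (induction \<alpha>) (simp_all add: T_seq_def expo_of_def var_T_def mult_single)

lemma f_seq_eq: "f_seq f \<alpha> = expo_comb f (expo_of \<alpha>)" for f :: "'n::finite \<Rightarrow> 'x expo"
  by (induction \<alpha>) (simp_all add: f_seq_def expo_of_def expo_comb_add expo_comb_single[simplified])

lemma weight_expo_of: "weight UNIV (expo_of \<alpha> :: 'n::finite \<Rightarrow>\<^sub>0 nat) = length \<alpha>"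
  by (induction \<alpha>) (simp_all add: expo_of_def weight_def[of _ 0])

lemma expo_of_seqs:
  fixes a :: "'n::{finite,linorder} \<Rightarrow>\<^sub>0 nat"
  obtains \<alpha> where "\<alpha> \<in> seqs (weight UNIV a)" "a = expo_of \<alpha>"
proof -
  have "\<exists>\<beta>. a = expo_of \<beta>"
  proof (induction "weight UNIV a" arbitrary: a)
    case 0
    then have "a = expo_of []"
      by (simp add: weight_eq_0_iff expo_of_def)
    then show ?case ..
  next
    case (Suc s)
    then have "weight UNIV a \<noteq> 0"
      by simp
    then obtain i where "Poly_Mapping.lookup a i > 0"
      by (auto simp: weight_def)
    then obtain a' where a: "a = a' + Poly_Mapping.single i 1"
      by (auto intro: split_off_single[of 1 a i])
    with Suc obtain \<beta> where "a' = expo_of \<beta>"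
      by auto
    then have "a = expo_of (i # \<beta>)"
      by (simp add: a expo_of_def add.commute)
    then show ?case ..
  qed
  then obtain \<beta> where \<beta>: "a = expo_of \<beta>" ..
  have "expo_of (sort \<beta>) = expo_of \<beta>"
    unfolding expo_of_def by (simp flip: sum_mset_sum_list)
  then have "a = expo_of (sort \<beta>)" "sort \<beta> \<in> seqs (weight UNIV a)"
    using \<beta> by (simp_all add: seqs_def weight_expo_of)
  then show ?thesis
    using that by blast
qed

lemma T_rel_eq:
  fixes f :: "'n::finite \<Rightarrow> 'x expo"
  defines "F \<equiv> expo_comb f"
  shows "(T_rel f \<alpha> \<beta> :: ('n, 'x, 'k::comm_ring_1) sring) =
    (let a = expo_of \<alpha>; b = expo_of \<beta>; g = gcd_expo (F a) (F b) in
       Poly_Mapping.single a (Poly_Mapping.single (F b - g) 1)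
       - Poly_Mapping.single b (Poly_Mapping.single (F a - g) 1))"
  by (simp add: T_rel_def Let_def T_seq_eq f_seq_eq const_S_def mono_of_def mult_single F_def)

lemma rees_hom_term:
  "rees_hom f (Poly_Mapping.single a (Poly_Mapping.single u k)) =
    Polynomial.monom (Poly_Mapping.single (u + expo_comb f a) k) (weight UNIV a)"
  by (simp add: rees_hom_single mono_of_def mult_single)

lemma J_set_subset_rees_ideal: "J_set f s \<subseteq> rees_ideal f"
  for f :: "'n::{finite,linorder} \<Rightarrow> 'x expo"
proof -
  \<comment> \<open>Both sides are the exponent of lcm, so the two terms of a relation have the same
    image.\<close>
  have "b - gcd_expo a b + a = a - gcd_expo a b + b" for a b :: "'x expo"
    by (rule poly_mapping_eqI) (simp add: lookup_add lookup_minus gcd_expo.rep_eq)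
  then show ?thesis
    by (auto simp: J_set_def seqs_def mem_rees_ideal T_rel_eq Let_def rees_hom_diff rees_hom_term weight_expo_of)
qed

text \<open>Square-freeness turns the exponent of x in \<open>f^m\<close> into the weight of m on
  the set of indices i with x dividing \<open>f_i\<close>. The inequality in \<open>bridge\<close>,
  tested on such sets, then bounds the exponents of \<open>f^c\<close>.\<close>

lemma lookup_expo_comb_squarefree:
  assumes "\<And>i. squarefree_expo (f i)"
  shows "Poly_Mapping.lookup (expo_comb f m) x = weight {i. Poly_Mapping.lookup (f i) x = 1} m"
proof -
  have "Poly_Mapping.lookup (f i) x = 0 \<or> Poly_Mapping.lookup (f i) x = 1" for i
    using assms[of i] by (auto simp: squarefree_expo_def le_Suc_eq)
  then have "Poly_Mapping.lookup m i * Poly_Mapping.lookup (f i) x =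
      (if i \<in> {i. Poly_Mapping.lookup (f i) x = 1} then Poly_Mapping.lookup m i else 0)" for i
    by (metis (mono_tags, lifting) mem_Collect_eq mult.right_neutral mult_0_right)
  then show ?thesis
    by (simp add: lookup_expo_comb weight_def sum.If_cases)
qed

text \<open>This is the exponent of a single variable in the following fact: u A = v B makes (u, v)
  a common multiple of (B/gcd(A,B), A/gcd(A,B)).\<close>

lemma cofactor_arith:
  fixes a b u v :: nat
  assumes "u + a = v + b"
  shows "u - (b - min a b) + (b - min a b) = u" "u - (b - min a b) + (a - min a b) = v"
  using assms by (cases "a \<le> b"; simp)+

text \<open>Strong induction on the degree: a shared variable is cancelled, small degrees are
  covered by the sets \<open>J_set f s\<close>, and in large degrees a bridge splits the binomial
  into two with a shared variable.\<close>

lemma binomial_mem_ideal: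
  fixes f :: "'n::{finite,linorder} \<Rightarrow> 'x expo" and Q :: "('n, 'x, 'k::comm_ring_1) sring set"
  assumes Q: "ideal Q typ_ring"
    and J: "\<And>s. 1 \<le> s \<Longrightarrow> s \<le> max 1 (CARD('n) - 2) \<Longrightarrow> J_set f s \<subseteq> Q"
    and sqf: "\<And>i. squarefree_expo (f i)" and n: "CARD('n) \<le> 5"
  shows "weight UNIV a = s \<Longrightarrow> weight UNIV b = s \<Longrightarrow> u + expo_comb f a = v + expo_comb f b \<Longrightarrow>
    Poly_Mapping.single a (Poly_Mapping.single u k) - Poly_Mapping.single b (Poly_Mapping.single v k) \<in> Q"
proof (induction s arbitrary: a b u v rule: less_induct)
  case (less s)
  let ?F = "expo_comb f"
  have common: "Poly_Mapping.single a (Poly_Mapping.single u k) - Poly_Mapping.single b (Poly_Mapping.single v k) \<in> Q"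
    if wt: "weight UNIV a = s" "weight UNIV b = s" and eq: "u + ?F a = v + ?F b"
      and i: "i \<in> Poly_Mapping.keys a" "i \<in> Poly_Mapping.keys b" for a b u v i
  proof -
    obtain a' where a: "a = a' + Poly_Mapping.single i 1"
      using i(1) by (auto intro: split_off_single[of 1 a i] simp: in_keys_iff)
    obtain b' where b: "b = b' + Poly_Mapping.single i 1"
      using i(2) by (auto intro: split_off_single[of 1 b i] simp: in_keys_iff)
    have "u + ?F a' = v + ?F b'"
      using eq by (simp add: a b expo_comb_add add.assoc[symmetric])
    then have "Poly_Mapping.single a' (Poly_Mapping.single u k) - Poly_Mapping.single b' (Poly_Mapping.single v k) \<in> Q"
      using wt by (intro less.IH[of "s - 1"]) (auto simp: a b)
    from ideal_mult[OF Q this, of "Poly_Mapping.single (Poly_Mapping.single i 1) 1"] show ?thesis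
      by (simp add: a b right_diff_distrib mult_single add.commute)
  qed
  \<comment> \<open>The maximum with 1 keeps the linear relations available when n \<le> 2, where
    the truncated difference n - 2 is 0.\<close>
  consider (meet) "Poly_Mapping.keys a \<inter> Poly_Mapping.keys b \<noteq> {}"
    | (zero) "s = 0"
    | (small) "1 \<le> s" "s \<le> max 1 (CARD('n) - 2)"
    | (large) "Poly_Mapping.keys a \<inter> Poly_Mapping.keys b = {}" "s > max 1 (CARD('n) - 2)"
    by (meson less_one not_le)
  then show ?case
  proof cases
    case meet
    then obtain i where "i \<in> Poly_Mapping.keys a" "i \<in> Poly_Mapping.keys b"
      by blast
    then show ?thesis
      by (rule common[OF less.prems])
  next
    case zero
    then have "a = 0" "b = 0"
      using less.prems(1,2) by (simp_all add: weight_eq_0_iff)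
    then show ?thesis
      using less.prems(3) by (simp add: ideal_zero[OF Q])
  next
    case small
    obtain \<alpha> where \<alpha>: "\<alpha> \<in> seqs s" "a = expo_of \<alpha>"
      using expo_of_seqs[of a] less.prems(1) by blast
    obtain \<beta> where \<beta>: "\<beta> \<in> seqs s" "b = expo_of \<beta>"
      using expo_of_seqs[of b] less.prems(2) by blast
    let ?g = "gcd_expo (?F a) (?F b)"
    have "T_rel f \<alpha> \<beta> \<in> Q"
      using J[OF small] \<alpha> \<beta> unfolding J_set_def by blast
    then have "Poly_Mapping.single 0 (Poly_Mapping.single (u - (?F b - ?g)) k) *
        (Poly_Mapping.single a (Poly_Mapping.single (?F b - ?g) 1)
         - Poly_Mapping.single b (Poly_Mapping.single (?F a - ?g) 1)) \<in> Q"
      by (intro ideal_mult[OF Q]) (simp add: T_rel_eq Let_def \<alpha> \<beta>)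
    moreover have pointwise: "Poly_Mapping.lookup u x + Poly_Mapping.lookup (?F a) x =
        Poly_Mapping.lookup v x + Poly_Mapping.lookup (?F b) x" for x
      using less.prems(3) by (metis lookup_add)
    have "u - (?F b - ?g) + (?F b - ?g) = u" "u - (?F b - ?g) + (?F a - ?g) = v"
      using cofactor_arith[OF pointwise]
      by (auto intro!: poly_mapping_eqI simp: lookup_add lookup_minus gcd_expo.rep_eq)
    ultimately show ?thesis
      by (simp add: right_diff_distrib mult_single)
  next
    case large
    obtain c where c: "bridge a b c"
      using bridge_exists[OF _ _ n, of a b] large less.prems(1,2) by auto
    \<comment> \<open>This is the exponent of the common image, a common multiple of
      \<open>f^a\<close> and \<open>f^b\<close>; hence \<open>f^c\<close> divides it, and the
      quotient \<open>y\<close> is the coefficient to put on \<open>T^c\<close>.\<close>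
    let ?w = "u + ?F a"
    have "Poly_Mapping.lookup (?F c) x \<le> Poly_Mapping.lookup ?w x" for x
    proof -
      have "Poly_Mapping.lookup (?F c) x \<le> max (Poly_Mapping.lookup (?F a) x) (Poly_Mapping.lookup (?F b) x)"
        using c by (simp add: lookup_expo_comb_squarefree[OF sqf] bridge_def)
      moreover have "Poly_Mapping.lookup ?w x = Poly_Mapping.lookup v x + Poly_Mapping.lookup (?F b) x"
        by (simp add: less.prems(3) lookup_add)
      ultimately show ?thesis
        by (simp add: lookup_add)
    qed
    then have y: "?w - ?F c + ?F c = ?w"
      by (intro poly_mapping_eqI) (simp add: lookup_add[of "_ - _"] lookup_minus)
    define y where "y = ?w - ?F c"
    have wc: "weight UNIV c = s"
      using c less.prems(1) by (simp add: bridge_def)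
    have meets: "Poly_Mapping.keys a \<inter> Poly_Mapping.keys c \<noteq> {}" "Poly_Mapping.keys b \<inter> Poly_Mapping.keys c \<noteq> {}"
      using c by (simp_all add: bridge_def)
    from meets(1) obtain i where i: "i \<in> Poly_Mapping.keys a" "i \<in> Poly_Mapping.keys c"
      by blast
    from meets(2) obtain j where j: "j \<in> Poly_Mapping.keys b" "j \<in> Poly_Mapping.keys c"
      by blast
    have "Poly_Mapping.single a (Poly_Mapping.single u k) - Poly_Mapping.single c (Poly_Mapping.single y k) \<in> Q"
      by (rule common[OF less.prems(1) wc _ i]) (simp add: y_def y)
    moreover have "Poly_Mapping.single b (Poly_Mapping.single v k) - Poly_Mapping.single c (Poly_Mapping.single y k) \<in> Q"
      by (rule common[OF less.prems(2) wc _ j]) (simp only: y_def y less.prems(3)[symmetric])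
    ultimately show ?thesis
      by (auto dest: ideal_diff[OF Q])
  qed
qed

text \<open>
  \<open>lift_poly f\<close> is an additive section of \<open>rees_hom f\<close> over its image, sending each term to a chosen
  term in its fiber. On monomials outside the image \<open>fiber_rep\<close> is arbitrary.
\<close>

definition fiber_rep :: "('n::finite \<Rightarrow> 'x expo) \<Rightarrow> nat \<Rightarrow> 'x expo \<Rightarrow> ('n \<Rightarrow>\<^sub>0 nat) \<times> 'x expo"
  where "fiber_rep f s w = (SOME (a, u). weight UNIV a = s \<and> u + expo_comb f a = w)"

definition lift_coeff :: "('n::finite \<Rightarrow> 'x expo) \<Rightarrow> nat \<Rightarrow> ('x, 'k::comm_ring_1) rring \<Rightarrow> ('n, 'x, 'k) sring"
  where "lift_coeff f s r = (\<Sum>w\<in>Poly_Mapping.keys r.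
    case fiber_rep f s w of (a, u) \<Rightarrow> Poly_Mapping.single a (Poly_Mapping.single u (Poly_Mapping.lookup r w)))"

definition lift_poly :: "('n::finite \<Rightarrow> 'x expo) \<Rightarrow> ('x, 'k::comm_ring_1) rring poly \<Rightarrow> ('n, 'x, 'k) sring"
  where "lift_poly f q = (\<Sum>i\<le>degree q. lift_coeff f i (Polynomial.coeff q i))"

lemma fiber_rep:
  assumes "weight UNIV a = s" "u + expo_comb f a = w"
  obtains a' u' where "fiber_rep f s w = (a', u')" "weight UNIV a' = s" "u' + expo_comb f a' = w"
proof -
  have "case fiber_rep f s w of (a, u) \<Rightarrow> weight UNIV a = s \<and> u + expo_comb f a = w"
    unfolding fiber_rep_def by (rule someI[of _ "(a, u)"]) (simp add: assms)
  then show ?thesis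
    using that by (auto split: prod.splits)
qed

lemma lift_coeff_zero [simp]: "lift_coeff f s 0 = 0"
  by (simp add: lift_coeff_def)

lemma lift_coeff_add: "lift_coeff f s (p + q) = lift_coeff f s p + lift_coeff f s q"
  unfolding lift_coeff_def by (rule setsum_keys_plus_distrib) (auto simp: single_add split: prod.splits)

lemma lift_poly_eq:
  "degree q \<le> N \<Longrightarrow> lift_poly f q = (\<Sum>i\<le>N. lift_coeff f i (Polynomial.coeff q i))"
  unfolding lift_poly_def by (rule sum.mono_neutral_left) (auto simp: coeff_eq_0)

lemma lift_poly_zero [simp]: "lift_poly f 0 = 0"
  by (simp add: lift_poly_def)

lemma lift_poly_add: "lift_poly f (p + q) = lift_poly f p + lift_poly f q"
  using degree_add_le_max[of p q]
  by (simp add: lift_poly_eq[of _ "max (degree p) (degree q)"] lift_coeff_add sum.distrib)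

lemma lift_poly_monom: "lift_poly f (Polynomial.monom r s) = lift_coeff f s r"
proof -
  have "lift_poly f (Polynomial.monom r s) = (\<Sum>i\<le>s. if i = s then lift_coeff f s r else 0)"
    unfolding lift_poly_eq[OF degree_monom_le] by (rule sum.cong) auto
  then show ?thesis
    by simp
qed

text \<open>Modulo \<open>Q\<close>, every p equals the lift of its image: for a term this is a
  binomial relation, and both sides are additive. On the kernel the lift is 0, so p itself lies in
  \<open>Q\<close>.\<close>

lemma rees_ideal_subset:
  fixes f :: "'n::{finite,linorder} \<Rightarrow> 'x expo" and Q :: "('n, 'x, 'k::comm_ring_1) sring set"
  assumes Q: "ideal Q typ_ring"
    and J: "\<And>s. 1 \<le> s \<Longrightarrow> s \<le> max 1 (CARD('n) - 2) \<Longrightarrow> J_set f s \<subseteq> Q"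
    and sqf: "\<And>i. squarefree_expo (f i)" and n: "CARD('n) \<le> 5"
  shows "rees_ideal f \<subseteq> Q"
proof
  have add_case: "p + q - lift_poly f (rees_hom f (p + q)) \<in> Q"
    if "p - lift_poly f (rees_hom f p) \<in> Q" "q - lift_poly f (rees_hom f q) \<in> Q" for p q
    using ideal_add[OF Q that] by (simp add: rees_hom_add lift_poly_add algebra_simps)
  have lift: "p - lift_poly f (rees_hom f p) \<in> Q" for p
  proof (induction p rule: poly_mapping_additive_induct)
    case zero
    then show ?case
      by (simp add: ideal_zero[OF Q])
  next
    case (single a r)
    show ?case
    proof (induction r rule: poly_mapping_additive_induct)
      case zero
      then show ?case
        by (simp add: ideal_zero[OF Q])
    next
      case (single u k)
      obtain a' u' where rep: "fiber_rep f (weight UNIV a) (u + expo_comb f a) = (a', u')"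
        and eq: "weight UNIV a' = weight UNIV a" "u' + expo_comb f a' = u + expo_comb f a"
        using fiber_rep[OF refl refl] by metis
      have "Poly_Mapping.single a (Poly_Mapping.single u k) - Poly_Mapping.single a' (Poly_Mapping.single u' k) \<in> Q"
        by (rule binomial_mem_ideal[OF Q J sqf n refl eq(1) eq(2)[symmetric]])
      moreover have "lift_poly f (rees_hom f (Poly_Mapping.single a (Poly_Mapping.single u k))) =
          Poly_Mapping.single a' (Poly_Mapping.single u' k)"
        by (cases "k = 0") (simp_all add: rees_hom_term lift_poly_monom lift_coeff_def rep)
      ultimately show ?case
        by simp
    next
      case (add p q)
      then show ?case
        unfolding single_add by (rule add_case)
    qed
  next
    case (add p q)
    then show ?case
      by (rule add_case)
  qed
  show "p \<in> Q" if "p \<in> rees_ideal f" for p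
    using lift[of p] that by (simp add: mem_rees_ideal)
qed

lemma rees_ideal_eq:
  fixes f :: "'n::{finite,linorder} \<Rightarrow> 'x expo"
  assumes "\<And>i. squarefree_expo (f i)" and "CARD('n) \<le> 5"
  shows "(rees_ideal f :: ('n, 'x, 'k::comm_ring_1) sring set) =
    ideal_gen (\<Union>s\<in>{1..max 1 (CARD('n) - 2)}. J_set f s)"
proof
  show "rees_ideal f \<subseteq> ideal_gen (\<Union>s\<in>{1..max 1 (CARD('n) - 2)}. J_set f s)"
    by (rule rees_ideal_subset[OF ideal_ideal_gen _ assms])
      (rule order_trans[OF _ ideal_gen_superset], force)
  show "ideal_gen (\<Union>s\<in>{1..max 1 (CARD('n) - 2)}. J_set f s) \<subseteq> rees_ideal f"
    by (rule ideal_gen_minimal[OF ideal_rees_ideal]) (use J_set_subset_rees_ideal in blast)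
qed

section \<open>The relation type\<close>

definition truncate :: "nat \<Rightarrow> ('n, 'x, 'k::comm_ring_1) sring \<Rightarrow> ('n, 'x, 'k) sring"
  where "truncate d p = (\<Sum>m\<in>Poly_Mapping.keys p.
    if weight UNIV m \<le> d then Poly_Mapping.single m (Poly_Mapping.lookup p m) else 0)"

lemma truncate_zero [simp]: "truncate d 0 = 0"
  by (simp add: truncate_def)

lemma truncate_add: "truncate d (p + q) = truncate d p + truncate d q"
  unfolding truncate_def by (rule setsum_keys_plus_distrib) (auto simp: single_add)

lemma truncate_single:
  "truncate d (Poly_Mapping.single m r) = (if weight UNIV m \<le> d then Poly_Mapping.single m r else 0)"
  by (cases "r = 0") (simp_all add: truncate_def)

lemma truncate_homogeneous:
  assumes "T_homogeneous e p"
  shows "truncate d p = (if e \<le> d then p else 0)"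
proof -
  have "truncate d p = (\<Sum>m\<in>Poly_Mapping.keys p.
      if e \<le> d then Poly_Mapping.single m (Poly_Mapping.lookup p m) else 0)"
    unfolding truncate_def using assms
    by (intro sum.cong refl) (simp add: T_homogeneous_def weight_def)
  then show ?thesis
    by (simp add: sum_single_keys)
qed

lemma truncate_single_mult:
  "truncate d (Poly_Mapping.single m r * p) =
    (if weight UNIV m \<le> d then Poly_Mapping.single m r * truncate (d - weight UNIV m) p else 0)"
proof (induction p rule: poly_mapping_additive_induct)
  case (single m' r')
  then show ?case
    by (auto simp: mult_single truncate_single)
next
  case (add p q)
  then show ?case
    by (simp add: distrib_left truncate_add)
qed simp

text \<open>The elements whose truncations at all d \<le> D lie in the smaller ideal form an ideal
  containing \<open>G\<close>. All d are taken at once because a factor of degree e lowers the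
  truncation bound from d to d - e.\<close>

lemma truncate_mem_ideal_gen:
  fixes G :: "('n::finite, 'x, 'k::comm_ring_1) sring set"
  assumes hom: "\<And>h. h \<in> G \<Longrightarrow> \<exists>e. T_homogeneous e h"
    and p: "p \<in> ideal_gen G" and "d \<le> D"
  shows "truncate d p \<in> ideal_gen {h \<in> G. \<exists>e\<le>D. T_homogeneous e h}" (is "_ \<in> ideal_gen ?G'")
proof -
  note Q = ideal_ideal_gen[of ?G']
  let ?K = "{p. \<forall>d\<le>D. truncate d p \<in> ideal_gen ?G'}"
  have mult: "r * p \<in> ?K" if "p \<in> ?K" for r p
  proof (induction r rule: poly_mapping_additive_induct)
    case (single m c)
    then show ?case
      using that by (auto simp: truncate_single_mult intro: ideal_zero[OF Q] ideal_mult[OF Q])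
  qed (auto simp: distrib_right truncate_add intro: ideal_zero[OF Q] ideal_add[OF Q])
  have "ideal ?K typ_ring"
    unfolding ideal_typ_ring_iff
    using mult by (auto simp: truncate_add intro: ideal_zero[OF Q] ideal_add[OF Q])
  moreover have "h \<in> ?K" if h: "h \<in> G" for h
  proof -
    obtain e where e: "T_homogeneous e h"
      using hom[OF h] ..
    have "h \<in> ideal_gen ?G'" if "e \<le> D"
      using h e that by (intro subsetD[OF ideal_gen_superset]) auto
    then show ?thesis
      by (auto simp: truncate_homogeneous[OF e] intro: ideal_zero[OF Q])
  qed
  ultimately have "ideal_gen G \<subseteq> ?K"
    by (intro ideal_gen_minimal) auto
  then show ?thesis
    using p \<open>d \<le> D\<close> by blast
qed

text \<open>The members of \<open>G\<close> of degree at most D already generate every element of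
  \<open>B\<close>, so minimality leaves no others in \<open>G\<close>.\<close>

lemma relation_type_le:
  fixes B :: "('n::finite, 'x, 'k::comm_ring_1) sring set"
  assumes B: "\<And>b. b \<in> B \<Longrightarrow> \<exists>e\<le>D. T_homogeneous e b"
  shows "relation_type (ideal_gen B) \<le> enat D"
  unfolding relation_type_def
proof (rule Sup_least)
  fix x
  assume "x \<in> {enat d |d g G. minimal_generating_set G (ideal_gen B) \<and>
    (\<forall>h\<in>G. \<exists>e. T_homogeneous e h) \<and> g \<in> G \<and> T_homogeneous d g}"
  then obtain d g G where x: "x = enat d" and gen: "ideal_gen G = ideal_gen B"
    and min: "\<And>G'. G' \<subset> G \<Longrightarrow> ideal_gen G' \<noteq> ideal_gen B"
    and hom: "\<And>h. h \<in> G \<Longrightarrow> \<exists>e. T_homogeneous e h"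
    and g: "g \<in> G" "T_homogeneous d g"
    by (auto simp: minimal_generating_set_def)
  have sub: "ideal_gen G' \<subseteq> ideal_gen B" if "G' \<subseteq> G" for G'
    using ideal_gen_superset[of G] that
    by (intro ideal_gen_minimal ideal_ideal_gen) (simp add: gen subset_trans)
  \<comment> \<open>The zero element is homogeneous of every degree, so it must be excluded before
    degrees can be compared.\<close>
  have "g \<noteq> 0"
  proof
    assume "g = 0"
    have "G \<subseteq> ideal_gen (G - {0})"
      using ideal_gen_superset[of "G - {0}"] ideal_zero[OF ideal_ideal_gen] by blast
    then have "ideal_gen B \<subseteq> ideal_gen (G - {0})"
      using ideal_gen_minimal[OF ideal_ideal_gen] gen by metis
    then show False
      using min[of "G - {0}"] sub[of "G - {0}"] g \<open>g = 0\<close> by blast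
  qed
  let ?G' = "{h \<in> G. \<exists>e\<le>D. T_homogeneous e h}"
  have "b \<in> ideal_gen ?G'" if b: "b \<in> B" for b
  proof -
    obtain e where "e \<le> D" "T_homogeneous e b"
      using B[OF b] by blast
    moreover have "truncate D b \<in> ideal_gen ?G'"
      using b ideal_gen_superset[of B] by (intro truncate_mem_ideal_gen hom) (auto simp: gen)
    ultimately show ?thesis
      by (simp add: truncate_homogeneous)
  qed
  then have "ideal_gen B \<subseteq> ideal_gen ?G'"
    by (intro ideal_gen_minimal ideal_ideal_gen) auto
  then have "g \<in> ?G'"
    using min[of ?G'] sub[of ?G'] g by blast
  then obtain e where "e \<le> D" "T_homogeneous e g"
    by blast
  \<comment> \<open>A monomial of \<open>g\<close> identifies its degree d with the bounded degree
    e.\<close>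
  moreover obtain m where "m \<in> Poly_Mapping.keys g"
    using \<open>g \<noteq> 0\<close> by (metis equals0I keys_eq_empty)
  ultimately have "d \<le> D"
    using g by (auto simp: T_homogeneous_def)
  then show "x \<le> enat D"
    by (simp add: x)
qed

lemma J_set_homogeneous: "p \<in> J_set f s \<Longrightarrow> T_homogeneous s p"
  for f :: "'n::{finite,linorder} \<Rightarrow> 'x expo"
  using keys_diff by (fastforce simp: J_set_def seqs_def T_rel_eq Let_def T_homogeneous_def
    simp flip: weight_def weight_expo_of split: if_splits)

theorem theorem2p12:
  fixes I :: "('x, 'k::field) rring set"
    and f :: "'n::{finite,linorder} \<Rightarrow> 'x expo"
  assumes "inj f"
    and "\<And>i. squarefree_expo (f i)"
    and "minimal_generating_set (range (\<lambda>i. mono_of (f i))) I"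
    and "CARD('n) \<le> 5"
  shows "(\<lambda>C. the_elem (rees_hom f ` C)) \<in>
           ring_iso (typ_ring Quot (rees_ideal f :: ('n, 'x, 'k) sring set)) (rees_ring I)
       \<and> (rees_ideal f :: ('n, 'x, 'k) sring set) =
           ideal_gen (J_set f 1) <+>\<^bsub>typ_ring\<^esub> ideal_gen (\<Union>i\<in>{2..CARD('n) - 2}. J_set f i)
       \<and> relation_type (rees_ideal f :: ('n, 'x, 'k) sring set) \<le> enat (max 1 (CARD('n) - 2))"
proof (intro conjI)
  show "(\<lambda>C. the_elem (rees_hom f ` C)) \<in>
      ring_iso (typ_ring Quot (rees_ideal f :: ('n, 'x, 'k) sring set)) (rees_ring I)"
    using assms(3) by (intro rees_ring_iso) (simp add: minimal_generating_set_def)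
next
  let ?J1 = "ideal_gen (J_set f 1) :: ('n, 'x, 'k) sring set"
  let ?J2 = "ideal_gen (\<Union>i\<in>{2..CARD('n) - 2}. J_set f i) :: ('n, 'x, 'k) sring set"
  have sum: "?J1 <+>\<^bsub>typ_ring\<^esub> ?J2 = ideal_gen (?J1 \<union> ?J2)"
    unfolding ideal_gen_def[of "_ \<union> _"]
    by (rule ring.union_genideal[OF ring_from_type_algebra ideal_ideal_gen ideal_ideal_gen, symmetric])
  have "J_set f s \<subseteq> ideal_gen (?J1 \<union> ?J2)" if "1 \<le> s" "s \<le> max 1 (CARD('n) - 2)" for s
  proof -
    \<comment> \<open>For n \<le> 3 the interval is empty and only s = 1 remains.\<close>
    have "s = 1 \<or> s \<in> {2..CARD('n) - 2}"
      using that by auto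
    then have "J_set f s \<subseteq> ?J1 \<union> ?J2"
      using ideal_gen_superset[of "J_set f 1"] ideal_gen_superset[of "\<Union>i\<in>{2..CARD('n) - 2}. J_set f i"]
      by blast
    then show ?thesis
      using ideal_gen_superset by blast
  qed
  then have "rees_ideal f \<subseteq> ideal_gen (?J1 \<union> ?J2)"
    by (rule rees_ideal_subset[OF ideal_ideal_gen _ assms(2,4)])
  moreover have "?J1 \<subseteq> rees_ideal f" "?J2 \<subseteq> rees_ideal f"
    using J_set_subset_rees_ideal by (auto intro!: ideal_gen_minimal[OF ideal_rees_ideal])
  then have "ideal_gen (?J1 \<union> ?J2) \<subseteq> rees_ideal f"
    by (intro ideal_gen_minimal[OF ideal_rees_ideal]) simp
  ultimately show "rees_ideal f = ?J1 <+>\<^bsub>typ_ring\<^esub> ?J2"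
    unfolding sum by simp
next
  show "relation_type (rees_ideal f :: ('n, 'x, 'k) sring set) \<le> enat (max 1 (CARD('n) - 2))"
    unfolding rees_ideal_eq[OF assms(2,4)]
    by (rule relation_type_le) (auto dest!: J_set_homogeneous)
qed

end
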